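(* Let $\Delta\geq 2$ be an integer and $0<\varepsilon<1/2$. If $c\geq (30\Delta/\varepsilon)\log(4e/\varepsilon)$, then with probability tending to $1$ as $n\to\infty$ the random graph $\mathcal{G}(n,c/n)$ contains a copy of every tree on at most $(1-\varepsilon)n$ vertices with maximum degree at most $\Delta$.
   Context: $\mathcal{G}(n,p)$ is the random graph on $n$ vertices in which each edge is present independently with probability $p$; $\log$ is the natural logarithm. *)

theory Defs
  imports "HOL-Probability.Probability" "HOL-Probability.Product_PMF" "HOL-Library.Ramsey"
begin

text \<open>Undirected graphs are pairs of a vertex set and a set of edges, an edge being a set of
  two vertices.  (The notion of tree in the digraph library is unsuitable for symmetric digraphs:
  there the walk \<open>a, b, a\<close> along an edge counts as a cycle.)\<close>

type_synonym 'a ugraph = "'a set \<times> 'a set set"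

abbreviation uverts :: "'a ugraph \<Rightarrow> 'a set" where
  "uverts G \<equiv> fst G"

abbreviation uedges :: "'a ugraph \<Rightarrow> 'a set set" where
  "uedges G \<equiv> snd G"

definition simple_graph :: "'a ugraph \<Rightarrow> bool" where
  "simple_graph G \<longleftrightarrow> finite (uverts G) \<and> uedges G \<subseteq> nsets (uverts G) 2"

definition ugraph_walk :: "'a ugraph \<Rightarrow> 'a list \<Rightarrow> bool" where
  "ugraph_walk G xs \<longleftrightarrow>
     xs \<noteq> [] \<and> set xs \<subseteq> uverts G \<and> successively (\<lambda>u v. {u, v} \<in> uedges G) xs"

definition ugraph_connected :: "'a ugraph \<Rightarrow> bool" where
  "ugraph_connected G \<longleftrightarrow> uverts G \<noteq> {} \<and>
     (\<forall>u\<in>uverts G. \<forall>v\<in>uverts G. \<exists>xs. ugraph_walk G xs \<and> hd xs = u \<and> last xs = v)"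

text \<open>A cycle is given by the list of its vertices, without repeating the first one at the end.\<close>

definition ugraph_cycle :: "'a ugraph \<Rightarrow> 'a list \<Rightarrow> bool" where
  "ugraph_cycle G xs \<longleftrightarrow>
     ugraph_walk G xs \<and> distinct xs \<and> length xs \<ge> 3 \<and> {last xs, hd xs} \<in> uedges G"

definition ugraph_tree :: "'a ugraph \<Rightarrow> bool" where
  "ugraph_tree G \<longleftrightarrow> simple_graph G \<and> ugraph_connected G \<and> (\<nexists>xs. ugraph_cycle G xs)"

definition ugraph_degree :: "'a ugraph \<Rightarrow> 'a \<Rightarrow> nat" where
  "ugraph_degree G v = card {e \<in> uedges G. v \<in> e}"

text \<open>Only meaningful for finite graphs with at least one vertex.\<close>

definition ugraph_max_degree :: "'a ugraph \<Rightarrow> nat" where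
  "ugraph_max_degree G = Max (ugraph_degree G ` uverts G)"

definition ugraph_subgraph :: "'a ugraph \<Rightarrow> 'a ugraph \<Rightarrow> bool" where
  "ugraph_subgraph H G \<longleftrightarrow>
     simple_graph H \<and> uverts H \<subseteq> uverts G \<and> uedges H \<subseteq> uedges G"

definition ugraph_isomorphic :: "'a ugraph \<Rightarrow> 'b ugraph \<Rightarrow> bool" where
  "ugraph_isomorphic G H \<longleftrightarrow> (\<exists>f. bij_betw f (uverts G) (uverts H) \<and>
     (\<forall>u\<in>uverts G. \<forall>v\<in>uverts G. {u, v} \<in> uedges G \<longleftrightarrow> {f u, f v} \<in> uedges H))"

definition contains_copy :: "'a ugraph \<Rightarrow> 'b ugraph \<Rightarrow> bool" where
  "contains_copy G T \<longleftrightarrow> (\<exists>H. ugraph_subgraph H G \<and> ugraph_isomorphic T H)"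

text \<open>The binomial random graph on the vertex set \<open>{0, \<dots>, n - 1}\<close>: one independent Bernoulli
  variable for each pair of vertices.  If \<open>p\<close> is outside the unit interval,
  \<^const>\<open>bernoulli_pmf\<close> truncates it to that interval; for \<open>p = c / n\<close> with fixed \<open>c > 0\<close>
  this concerns only finitely many \<open>n\<close>.\<close>

definition gnp :: "nat \<Rightarrow> real \<Rightarrow> nat ugraph pmf" where
  "gnp n p = map_pmf (\<lambda>X. ({..<n}, {e \<in> nsets {..<n} 2. X e}))
     (Pi_pmf (nsets {..<n} 2) False (\<lambda>_. bernoulli_pmf p))"

end

theory Submission
  imports Defs "HOL-Real_Asymp.Real_Asymp"
begin

text \<open>A graph in which any two disjoint vertex sets of sizes \<open>m\<close> and \<open>b\<close> are joined by an edge becomes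
  an expander once a maximum non-expanding set (of fewer than \<open>m\<close> vertices) is deleted. In an expander
  every bounded degree tree can be grown leaf by leaf, by the method of Friedman, Pippenger and
  Haxell: one keeps the invariant that each set of at most \<open>m\<close> vertices has enough unoccupied neighbours
  to accommodate all the children that its members may still need. For \<open>m = \<epsilon> n / (7 \<Delta>)\<close> and
  \<open>b = \<epsilon> n / 2\<close> this reaches \<open>(1 - \<epsilon>) n\<close> vertices, and a union bound over all pairs of sets shows
  that the random graph satisfies the hypothesis with high probability.\<close>

section \<open>Trees\<close>

lemma successively_leaves_set:
  assumes "successively P xs" "xs \<noteq> []" "hd xs \<in> S" "last xs \<notin> S"
  shows "\<exists>u v. u \<in> S \<and> v \<notin> S \<and> u \<in> set xs \<and> v \<in> set xs \<and> P u v"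
  using assms
proof (induction xs)
  case (Cons x xs)
  show ?case
  proof (cases "xs = []")
    case False
    then have *: "P x (hd xs)" "successively P xs"
      using Cons.prems by (auto simp: successively_Cons)
    show ?thesis
    proof (cases "hd xs \<in> S")
      case True
      then show ?thesis using Cons False * by auto
    next
      case out: False
      show ?thesis using Cons.prems * out False
        by (intro exI[of _ x] exI[of _ "hd xs"]) auto
    qed
  qed (use Cons in auto)
qed simp

text \<open>This supplies the next vertex when a tree is grown inside a connected graph: a walk that
  starts in \<open>S\<close> and ends outside must leave \<open>S\<close> at some step. The pair
  \<open>(S, E)\<close> used below keeps all edges of \<open>E\<close>; walks in it are confined to
  \<open>S\<close> by their vertices alone, so it acts as the induced subgraph.\<close>

lemma ugraph_connected_boundary_edge:
  assumes "ugraph_connected (V, E)" "S \<subseteq> V" "S \<noteq> {}" "S \<noteq> V"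
  obtains s w where "s \<in> S" "w \<in> V - S" "{s, w} \<in> E"
proof -
  obtain a b where "a \<in> S" "b \<in> V - S" using assms by blast
  then obtain xs where "ugraph_walk (V, E) xs" "hd xs = a" "last xs = b"
    using assms(1,2) unfolding ugraph_connected_def by fastforce
  then have "\<exists>u v. u \<in> S \<and> v \<notin> S \<and> u \<in> set xs \<and> v \<in> set xs \<and> {u, v} \<in> E"
    using \<open>a \<in> S\<close> \<open>b \<in> V - S\<close>
    by (intro successively_leaves_set[where P = "\<lambda>u v. {u, v} \<in> E"]) (auto simp: ugraph_walk_def)
  then show ?thesis
    using \<open>ugraph_walk (V, E) xs\<close> by (auto simp: ugraph_walk_def intro: that)
qed

text \<open>A shortest walk repeats no vertex, since the stretch between two occurrences could be
  cut out.\<close>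

lemma ugraph_connected_distinct_walk:
  assumes "ugraph_connected G" "u \<in> uverts G" "v \<in> uverts G"
  obtains xs where "ugraph_walk G xs" "distinct xs" "hd xs = u" "last xs = v"
proof -
  let ?W = "\<lambda>xs. ugraph_walk G xs \<and> hd xs = u \<and> last xs = v"
  obtain zs where zs: "?W zs" using assms by (auto simp: ugraph_connected_def)
  define xs where "xs = arg_min length ?W"
  have xs: "?W xs" using arg_min_nat_lemma[of ?W, OF zs, of length] by (simp add: xs_def)
  have min: "length xs \<le> length ys" if "?W ys" for ys
    using arg_min_nat_lemma[of ?W, OF zs, of length] that by (auto simp: xs_def)
  have "distinct xs"
  proof (rule ccontr)
    assume "\<not> distinct xs"
    then obtain as bs cs x where eq: "xs = as @ [x] @ bs @ [x] @ cs"
      using not_distinct_decomp by blast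
    have "?W (as @ [x] @ cs)"
      using xs unfolding eq ugraph_walk_def
      by (auto simp: successively_append_iff successively_Cons hd_append)
    from min[OF this] show False by (simp add: eq)
  qed
  with xs that show ?thesis by blast
qed

text \<open>Two different neighbours of \<open>w\<close> in \<open>S\<close> are joined by a walk
  inside \<open>S\<close> without repetitions, and \<open>w\<close> closes it to a cycle.\<close>

lemma ugraph_tree_unique_attachment:
  assumes "ugraph_tree (V, E)" "S \<subseteq> V" "ugraph_connected (S, E)" "w \<in> V - S"
    and "s \<in> S" "s' \<in> S" "{s, w} \<in> E" "{s', w} \<in> E"
  shows "s = s'"
proof (rule ccontr)
  assume "s \<noteq> s'"
  obtain xs where xs: "ugraph_walk (S, E) xs" "distinct xs" "hd xs = s" "last xs = s'"
    using ugraph_connected_distinct_walk[OF assms(3)] assms(5,6) by auto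
  \<comment> \<open>As the endpoints differ, the walk has at least two vertices, so that
    \<open>w # xs\<close> has the three vertices a cycle needs.\<close>
  obtain x y ys where "xs = x # y # ys"
    using xs \<open>s \<noteq> s'\<close> by (cases xs; cases "tl xs") (auto simp: ugraph_walk_def)
  then have "ugraph_cycle (V, E) (w # xs)"
    using xs assms by (auto simp: ugraph_cycle_def ugraph_walk_def insert_commute)
  with assms(1) show False by (auto simp: ugraph_tree_def)
qed

lemma ugraph_connected_insert:
  assumes "ugraph_connected (S, E)" "s \<in> S" "{s, w} \<in> E"
  shows "ugraph_connected (insert w S, E)"
proof -
  have walk: "\<exists>xs. ugraph_walk (S, E) xs \<and> hd xs = u \<and> last xs = v" if "u \<in> S" "v \<in> S" for u v
    using assms(1) that by (auto simp: ugraph_connected_def)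
  have mono: "ugraph_walk (insert w S, E) xs" if "ugraph_walk (S, E) xs" for xs
    using that by (auto simp: ugraph_walk_def)
  have 1: "\<exists>xs. ugraph_walk (insert w S, E) xs \<and> hd xs = w \<and> last xs = v" if v: "v \<in> S" for v
  proof -
    obtain xs where "ugraph_walk (S, E) xs" "hd xs = s" "last xs = v"
      using walk[OF assms(2) v] by blast
    then show ?thesis using assms
      by (intro exI[of _ "w # xs"]) (auto simp: ugraph_walk_def successively_Cons insert_commute)
  qed
  have 2: "\<exists>xs. ugraph_walk (insert w S, E) xs \<and> hd xs = v \<and> last xs = w" if v: "v \<in> S" for v
  proof -
    obtain xs where "ugraph_walk (S, E) xs" "hd xs = v" "last xs = s"
      using walk[OF v assms(2)] by blast
    then show ?thesis using assms
      by (intro exI[of _ "xs @ [w]"]) (auto simp: ugraph_walk_def successively_append_iff)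
  qed
  have 3: "\<exists>xs. ugraph_walk (insert w S, E) xs \<and> hd xs = w \<and> last xs = w"
    by (intro exI[of _ "[w]"]) (auto simp: ugraph_walk_def)
  show ?thesis
    unfolding ugraph_connected_def using 1 2 3 walk mono by (auto; meson)
qed

text \<open>The embedding counts neighbours whereas \<open>ugraph_degree\<close> counts edges;
  \<open>u\<close> maps injectively to the edge \<open>{u, v}\<close>.\<close>

lemma simple_graph_degree_ge:
  assumes "simple_graph G" "v \<in> uverts G"
  shows "card {u. {u, v} \<in> uedges G} \<le> ugraph_degree G v"
proof -
  have fin: "finite {e \<in> uedges G. v \<in> e}"
    using assms by (auto simp: simple_graph_def intro!: finite_subset[OF _ finite_imp_finite_nsets])
  have "inj_on (\<lambda>u. {u, v}) {u. {u, v} \<in> uedges G}"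
    by (auto simp: inj_on_def doubleton_eq_iff)
  then show ?thesis unfolding ugraph_degree_def
    by (intro card_inj_on_le[OF _ _ fin]) auto
qed

section \<open>Embedding trees in expanding graphs\<close>

text \<open>The room a set \<open>X\<close> leaves for continuing an embedding that occupies the vertices \<open>W\<close> and
  has already attached \<open>d x\<close> of the at most \<open>D\<close> children to each vertex \<open>x\<close>.\<close>

definition embedding_slack :: "('a \<Rightarrow> 'a set) \<Rightarrow> nat \<Rightarrow> 'a set \<Rightarrow> ('a \<Rightarrow> nat) \<Rightarrow> 'a set \<Rightarrow> int" where
  "embedding_slack N D W d X = int (card (\<Union>(N ` X) - W)) - (\<Sum>x\<in>X. int D - int (d x))"

text \<open>The size of a union of neighbourhoods is a coverage function, hence submodular: a
  neighbour of \<open>A \<inter> B\<close> is a neighbour of both sets. The subtracted demand is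
  modular.\<close>

lemma embedding_slack_submodular:
  assumes "finite A" "finite B" "\<And>x. x \<in> A \<union> B \<Longrightarrow> finite (N x)"
  shows "embedding_slack N D W d (A \<union> B) + embedding_slack N D W d (A \<inter> B)
           \<le> embedding_slack N D W d A + embedding_slack N D W d B"
proof -
  let ?c = "\<lambda>X. \<Union>(N ` X) - W"
  have fin: "finite (?c A)" "finite (?c B)" using assms by auto
  have "card (?c (A \<union> B)) + card (?c (A \<inter> B)) \<le> card (?c A \<union> ?c B) + card (?c A \<inter> ?c B)"
    using fin by (intro add_mono card_mono) auto
  also have "\<dots> = card (?c A) + card (?c B)" using card_Un_Int[OF fin] by simp
  finally show ?thesis
    unfolding embedding_slack_def using sum.union_inter[OF assms(1,2), of "\<lambda>x. int D - int (d x)"]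
    by linarith
qed

text \<open>Occupying \<open>y\<close> takes one free neighbour from every \<open>X\<close> that
  sees \<open>y\<close>, and the child attached to \<open>s\<close> reduces the demand of every
  \<open>X\<close> containing \<open>s\<close>. So the slack falls, by one, only when
  \<open>X\<close> sees \<open>y\<close> and misses \<open>s\<close>.\<close>

lemma embedding_slack_extend:
  assumes "finite X" "\<And>x. x \<in> X \<Longrightarrow> finite (N x)" "y \<notin> W"
  shows "embedding_slack N D (insert y W) (d(s := Suc (d s))) X
           = embedding_slack N D W d X - of_bool (y \<in> \<Union>(N ` X)) + of_bool (s \<in> X)"
proof -
  let ?c = "\<Union>(N ` X) - W"
  have "finite ?c" using assms by auto
  then have "int (card (\<Union>(N ` X) - insert y W)) = int (card ?c) - of_bool (y \<in> \<Union>(N ` X))"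
    using assms(3) card_Suc_Diff1[of ?c y]
    by (subst Diff_insert) (cases "y \<in> ?c"; auto)
  moreover have "(\<Sum>x\<in>X. int D - int ((d(s := Suc (d s))) x))
      = (\<Sum>x\<in>X. (int D - int (d x)) - (if x = s then 1 else 0))"
    by (intro sum.cong) auto
  moreover have "\<dots> = (\<Sum>x\<in>X. int D - int (d x)) - of_bool (s \<in> X)"
    using assms(1) by (subst sum_subtractf) simp
  ultimately show ?thesis by (simp only: embedding_slack_def)
qed

text \<open>If no choice of \<open>y\<close> works, each \<open>y\<close> is blocked by a set of slack 0. By submodularity the union
  of these sets has slack 0 too; adding \<open>s\<close> to it contributes no new neighbours, so it makes the
  slack negative.\<close>

lemma embedding_slack_step:
  fixes N :: "'a \<Rightarrow> 'a set"
  assumes V: "finite V" "\<And>x. x \<in> V \<Longrightarrow> N x \<subseteq> V"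
    and m: "m \<ge> 1"
    and large: "\<And>X. X \<subseteq> V \<Longrightarrow> m < card X \<Longrightarrow> card X \<le> 2 * m \<Longrightarrow> D * card X + M \<le> card (\<Union>(N ` X))"
    and good: "\<And>X. X \<subseteq> V \<Longrightarrow> card X \<le> m \<Longrightarrow> 0 \<le> embedding_slack N D W d X"
    and W: "finite W" "card W < M" and s: "s \<in> V" "d s < D"
  shows "\<exists>y\<in>N s - W. \<forall>X\<subseteq>V. card X \<le> m \<longrightarrow>
           0 \<le> embedding_slack N D (insert y W) (d(s := Suc (d s))) X"
proof (rule ccontr)
  assume neg: "\<not> ?thesis"
  let ?R = "embedding_slack N D W d"
  have finV: "finite X" "\<And>x. x \<in> X \<Longrightarrow> finite (N x)" if "X \<subseteq> V" for X
    using that V finite_subset by (blast, meson finite_subset subsetD)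
  \<comment> \<open>In this range the surplus \<open>M\<close> exceeds the number of occupied
    vertices, so the slack is positive even if every member of \<open>X\<close> still needs all
    \<open>D\<close> children.\<close>
  have pos: "0 < ?R X" if X: "X \<subseteq> V" "m < card X" "card X \<le> 2 * m" for X
  proof -
    have "D * card X + M \<le> card (\<Union>(N ` X))" using large X by simp
    also have "\<dots> \<le> card (\<Union>(N ` X) - W) + card W"
      using diff_card_le_card_Diff[OF W(1), of "\<Union>(N ` X)"] by linarith
    finally have "D * card X < card (\<Union>(N ` X) - W)" using W by linarith
    then have "int D * int (card X) < int (card (\<Union>(N ` X) - W))"
      by (metis of_nat_less_iff of_nat_mult)
    moreover have "(\<Sum>x\<in>X. int D - int (d x)) \<le> int (card X) * int D"
      by (intro sum_bounded_above) auto
    ultimately show ?thesis by (simp add: embedding_slack_def mult.commute)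
  qed
  have nonneg: "0 \<le> ?R X" if "X \<subseteq> V" "card X \<le> 2 * m" for X
    using good[of X] pos[of X] that by (cases "card X \<le> m") auto
  \<comment> \<open>By \<open>embedding_slack_extend\<close> these are the only sets of at most
    \<open>m\<close> vertices whose slack can become negative.\<close>
  define crit where "crit = {X. X \<subseteq> V \<and> card X \<le> m \<and> ?R X = 0 \<and> s \<notin> X}"
  have Un: "A \<union> B \<in> crit" if "A \<in> crit" "B \<in> crit" for A B
  proof -
    have AB: "A \<subseteq> V" "B \<subseteq> V" "card A \<le> m" "card B \<le> m" "?R A = 0" "?R B = 0" "s \<notin> A \<union> B"
      using that by (auto simp: crit_def)
    have "card (A \<inter> B) \<le> card A" using AB finV by (intro card_mono) auto
    then have "0 \<le> ?R (A \<inter> B)" using AB by (intro good) auto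
    moreover have "?R (A \<union> B) + ?R (A \<inter> B) \<le> ?R A + ?R B"
      using AB finV by (intro embedding_slack_submodular) auto
    ultimately have le: "?R (A \<union> B) \<le> 0" using AB by linarith
    \<comment> \<open>A union with more than \<open>m\<close> elements would have positive slack by
      \<open>pos\<close>, so the union falls back to size at most \<open>m\<close> and is critical
      again.\<close>
    have c: "card (A \<union> B) \<le> 2 * m" using card_Un_le[of A B] AB by linarith
    then have "card (A \<union> B) \<le> m" using pos[of "A \<union> B"] AB le by fastforce
    then show ?thesis using le AB nonneg[of "A \<union> B"] c by (auto simp: crit_def)
  qed
  have blocked: "\<exists>X\<in>crit. y \<in> \<Union>(N ` X)" if y: "y \<in> N s - W" for y
  proof -
    obtain X where X: "X \<subseteq> V" "card X \<le> m"
      "embedding_slack N D (insert y W) (d(s := Suc (d s))) X < 0"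
      using neg y by (meson not_le)
    have "?R X - of_bool (y \<in> \<Union>(N ` X)) + of_bool (s \<in> X) < 0"
      using X y finV by (subst embedding_slack_extend[symmetric]) auto
    then show ?thesis using good[OF X(1,2)] X(1,2)
      by (intro bexI[of _ X]) (auto simp: crit_def of_bool_def split: if_splits)
  qed
  have "\<exists>X\<in>crit. Y \<subseteq> \<Union>(N ` X)" if "finite Y" "Y \<subseteq> N s - W" for Y
    using that
  proof (induction Y rule: finite_induct)
    case empty
    have "{} \<in> crit" by (simp add: crit_def embedding_slack_def)
    then show ?case by blast
  next
    case (insert y Y)
    then obtain X X' where "X \<in> crit" "Y \<subseteq> \<Union>(N ` X)" "X' \<in> crit" "y \<in> \<Union>(N ` X')"
      using blocked[of y] by auto
    then show ?case using Un[of X X'] by (intro bexI[of _ "X \<union> X'"]) auto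
  qed
  moreover have "finite (N s - W)" using finV[of V] s by auto
  ultimately have "\<exists>X\<in>crit. N s - W \<subseteq> \<Union>(N ` X)" by blast
  then obtain X where X: "X \<in> crit" "N s - W \<subseteq> \<Union>(N ` X)" by blast
  then have X': "X \<subseteq> V" "card X \<le> m" "?R X = 0" "s \<notin> X" "finite X"
    using finV by (auto simp: crit_def)
  have "\<Union>(N ` insert s X) - W = \<Union>(N ` X) - W" using X by auto
  then have "?R (insert s X) < 0"
    using X' s(2) by (simp add: embedding_slack_def)
  \<comment> \<open>The enlarged set may have \<open>m + 1\<close> elements; this is at most
    \<open>2 * m\<close> because \<open>m \<ge> 1\<close>.\<close>
  moreover have "0 \<le> ?R (insert s X)" using X' s m by (intro nonneg) auto
  ultimately show False by simp
qed


text \<open>The tree is exposed one vertex at a time, each new vertex being a leaf attached to the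
  connected part already embedded, and \<open>embedding_slack_step\<close> finds a place for
  it.\<close>

lemma expander_embeds_tree:
  fixes V :: "'a set" and VT :: "'b set" and E ET D m M
  defines "N \<equiv> \<lambda>x. {y \<in> V. {x, y} \<in> E}"
  assumes V: "finite V" "V \<noteq> {}" and m: "m \<ge> 1"
    and small: "\<And>X. X \<subseteq> V \<Longrightarrow> X \<noteq> {} \<Longrightarrow> card X \<le> m \<Longrightarrow> D * card X < card (\<Union>(N ` X))"
    and large: "\<And>X. X \<subseteq> V \<Longrightarrow> m < card X \<Longrightarrow> card X \<le> 2 * m \<Longrightarrow> D * card X + M \<le> card (\<Union>(N ` X))"
    and T: "ugraph_tree (VT, ET)" "card VT \<le> M" "\<And>v. v \<in> VT \<Longrightarrow> card {u. {u, v} \<in> ET} \<le> D"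
  shows "\<exists>f. inj_on f VT \<and> f ` VT \<subseteq> V \<and> (\<forall>u v. {u, v} \<in> ET \<longrightarrow> {f u, f v} \<in> E)"
proof -
  have T': "finite VT" "VT \<noteq> {}" "ET \<subseteq> nsets VT 2" "ugraph_connected (VT, ET)"
    using T(1) by (auto simp: ugraph_tree_def simple_graph_def ugraph_connected_def)
  have edge: "u \<in> VT \<and> v \<in> VT \<and> u \<noteq> v" if "{u, v} \<in> ET" for u v
    using T'(3) that by (metis doubleton_in_nsets_2 subsetD)
  have fin: "finite {u. {u, v} \<in> ET}" for v
    using edge T'(1) by (auto intro: finite_subset[of _ VT])
  \<comment> \<open>The counter \<open>d\<close> is indexed by vertices of the host graph. Bounding
    it by the degree inside \<open>S\<close> leaves room at a boundary vertex, whose neighbour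
    outside \<open>S\<close> is not yet counted; its vanishing off the image lets a newly occupied
    vertex start without children.\<close>
  have "\<exists>S f d. S \<subseteq> VT \<and> card S = Suc k \<and> ugraph_connected (S, ET) \<and> inj_on f S \<and> f ` S \<subseteq> V \<and>
      (\<forall>u\<in>S. \<forall>v\<in>S. {u, v} \<in> ET \<longrightarrow> {f u, f v} \<in> E) \<and>
      (\<forall>x. x \<notin> f ` S \<longrightarrow> d x = 0) \<and> (\<forall>v\<in>S. d (f v) \<le> card {u \<in> S. {u, v} \<in> ET}) \<and>
      (\<forall>X\<subseteq>V. card X \<le> m \<longrightarrow> 0 \<le> embedding_slack N D (f ` S) d X)"
    if "Suc k \<le> card VT" for k
    using that
  proof (induction k)
    case 0
    obtain r where r: "r \<in> VT" using T' by blast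
    obtain x where x: "x \<in> V" using V by blast
    have conn: "ugraph_connected ({r}, ET)"
      by (auto simp: ugraph_connected_def ugraph_walk_def intro!: exI[of _ "[r]"])
    have slack: "0 \<le> embedding_slack N D {x} (\<lambda>_. 0) X" if X: "X \<subseteq> V" "card X \<le> m" for X
    proof (cases "X = {}")
      case False
      \<comment> \<open>The strict inequality in \<open>small\<close> pays for the single occupied
        vertex \<open>x\<close>.\<close>
      have "D * card X \<le> card (\<Union>(N ` X) - {x})"
        using small[OF X(1) False X(2)] diff_card_le_card_Diff[of "{x}" "\<Union>(N ` X)"] by auto
      then have "int (card X) * int D \<le> int (card (\<Union>(N ` X) - {x}))"
        by (metis mult.commute of_nat_le_iff of_nat_mult)
      then show ?thesis by (simp add: embedding_slack_def)
    qed (simp add: embedding_slack_def)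
    have "{r} \<notin> ET" using edge[of r r] by auto
    then show ?case
      using r x conn slack
      by (intro exI[of _ "{r}"] exI[of _ "\<lambda>_. x"] exI[of _ "\<lambda>_. 0"]) auto
  next
    case (Suc k)
    have "Suc k \<le> card VT" using Suc.prems by simp
    from Suc.IH[OF this] obtain S f d where S: "S \<subseteq> VT" "card S = Suc k" "ugraph_connected (S, ET)"
      and f0: "inj_on f S" "f ` S \<subseteq> V" "\<forall>u\<in>S. \<forall>v\<in>S. {u, v} \<in> ET \<longrightarrow> {f u, f v} \<in> E"
      and d0: "\<forall>x. x \<notin> f ` S \<longrightarrow> d x = 0" "\<forall>v\<in>S. d (f v) \<le> card {u \<in> S. {u, v} \<in> ET}"
      and good0: "\<forall>X\<subseteq>V. card X \<le> m \<longrightarrow> 0 \<le> embedding_slack N D (f ` S) d X"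
      by (elim exE conjE) (rule that; assumption)
    note f = f0(1,2) f0(3)[rule_format] and d = d0[rule_format] and good = good0[rule_format]
    have finS: "finite S" using S T' finite_subset by blast
    have "S \<noteq> {}" "S \<noteq> VT" using S Suc.prems by auto
    then obtain s w where sw: "s \<in> S" "w \<in> VT - S" "{s, w} \<in> ET"
      using ugraph_connected_boundary_edge[OF T'(4) S(1)] by blast
    \<comment> \<open>Acyclicity enters here: \<open>w\<close> has only one neighbour in
      \<open>S\<close>, so its image has to be adjacent to \<open>f s\<close> alone.\<close>
    have uniq: "u = s" if "u \<in> S" "{u, w} \<in> ET" for u
      using ugraph_tree_unique_attachment[OF T(1) S(1,3) sw(2) that(1) sw(1) that(2) sw(3)] .
    have "d (f s) \<le> card {u \<in> S. {u, s} \<in> ET}" using d(2)[OF sw(1)] .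
    also have "\<dots> < card {u. {u, s} \<in> ET}"
    proof (rule psubset_card_mono[OF fin])
      have "w \<in> {u. {u, s} \<in> ET}" "w \<notin> S" using sw by (simp_all add: insert_commute)
      then show "{u \<in> S. {u, s} \<in> ET} \<subset> {u. {u, s} \<in> ET}" by blast
    qed
    also have "\<dots> \<le> D" using T(3) sw S by blast
    finally have ds: "d (f s) < D" .
    have "card (f ` S) < M" using card_image[OF f(1)] S(2) Suc.prems T(2) by simp
    moreover have "N x \<subseteq> V" for x by (auto simp: N_def)
    ultimately have "\<exists>y\<in>N (f s) - f ` S. \<forall>X\<subseteq>V. card X \<le> m \<longrightarrow>
        0 \<le> embedding_slack N D (insert y (f ` S)) (d(f s := Suc (d (f s)))) X"
      using V(1) m large good finS ds f(2) sw(1)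
      by (intro embedding_slack_step[where M = M]) auto
    then obtain y where y: "y \<in> N (f s) - f ` S"
      and good': "\<forall>X\<subseteq>V. card X \<le> m \<longrightarrow>
        0 \<le> embedding_slack N D (insert y (f ` S)) (d(f s := Suc (d (f s)))) X"
      by (elim bexE)
    define g where "g = f(w := y)"
    define e where "e = d(f s := Suc (d (f s)))"
    have gS: "g u = f u" if "u \<in> S" for u using that sw by (auto simp: g_def)
    have gw: "g w = y" by (simp add: g_def)
    have img: "g ` insert w S = insert y (f ` S)" using gS gw by auto
    have fsy: "{f s, y} \<in> E" "y \<in> V" "y \<notin> f ` S" using y by (auto simp: N_def)
    have inj: "inj_on g (insert w S)"
      using f(1) sw fsy gS by (auto simp: inj_on_def gw)
    have hom: "{g u, g v} \<in> E" if "u \<in> insert w S" "v \<in> insert w S" "{u, v} \<in> ET" for u v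
      using that edge[OF that(3)] uniq[of u] uniq[of v] fsy gS f(3) gw
      by (auto simp: insert_commute)
    have e0: "e x = 0" if "x \<notin> g ` insert w S" for x
      using that d(1) sw(1) unfolding img e_def by auto
    have ed: "e (g v) \<le> card {u \<in> insert w S. {u, v} \<in> ET}" if v: "v \<in> insert w S" for v
    proof (cases "v = w")
      case True
      then show ?thesis using fsy sw d(1) by (auto simp: gw e_def)
    next
      case False
      then have "v \<in> S" using v by auto
      show ?thesis
      proof (cases "v = s")
        case True
        have "{u \<in> insert w S. {u, s} \<in> ET} = insert w {u \<in> S. {u, s} \<in> ET}"
          using sw by (auto simp: insert_commute)
        then have "card {u \<in> insert w S. {u, s} \<in> ET} = Suc (card {u \<in> S. {u, s} \<in> ET})"
          using sw finS by auto
        then show ?thesis using True d(2)[of s] sw gS by (simp add: e_def)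
      next
        case False
        have "f v \<noteq> f s" using f(1) False \<open>v \<in> S\<close> sw by (auto simp: inj_on_def)
        then have "e (g v) = d (f v)" using gS \<open>v \<in> S\<close> by (simp add: e_def)
        also have "\<dots> \<le> card {u \<in> S. {u, v} \<in> ET}" using d \<open>v \<in> S\<close> by blast
        also have "\<dots> \<le> card {u \<in> insert w S. {u, v} \<in> ET}"
          using finS by (intro card_mono) auto
        finally show ?thesis .
      qed
    qed
    show ?case
      apply (intro exI[of _ "insert w S"] exI[of _ g] exI[of _ e] conjI)
      subgoal using S sw by auto
      subgoal using S sw finS by auto
      subgoal using ugraph_connected_insert[OF S(3) sw(1,3)] .
      subgoal using inj .
      subgoal unfolding img using fsy f by auto
      subgoal using hom by blast
      subgoal using e0 by blast
      subgoal using ed by blast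
      subgoal unfolding img e_def using good' by blast
      done
  qed
  \<comment> \<open>The induction is indexed so that \<open>k\<close> corresponds to
    \<open>k + 1\<close> embedded vertices.\<close>
  from this[of "card VT - 1"] T'
  obtain S f where S: "S \<subseteq> VT" "card S = card VT" "inj_on f S" "f ` S \<subseteq> V"
      "\<forall>u\<in>S. \<forall>v\<in>S. {u, v} \<in> ET \<longrightarrow> {f u, f v} \<in> E"
    by (auto simp: card_gt_0_iff)
  have "S = VT" using S T' by (intro card_subset_eq)
  have "{f u, f v} \<in> E" if "{u, v} \<in> ET" for u v
    using S(5) edge[OF that] that unfolding \<open>S = VT\<close> by simp
  then show ?thesis using S(3,4) unfolding \<open>S = VT\<close> by (intro exI[of _ f]) simp
qed

section \<open>Graphs without large bipartite holes\<close>

text \<open>Sizes are exact so that a union bound runs over sets of fixed size; larger sets are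
  treated by passing to subsets.\<close>

definition joined :: "nat \<Rightarrow> nat \<Rightarrow> 'a ugraph \<Rightarrow> bool" where
  "joined a b G \<longleftrightarrow> (\<forall>A B. A \<subseteq> uverts G \<and> B \<subseteq> uverts G \<and> A \<inter> B = {} \<and> card A = a \<and> card B = b
     \<longrightarrow> (\<exists>x\<in>A. \<exists>y\<in>B. {x, y} \<in> uedges G))"

text \<open>Fewer than \<open>b\<close> vertices lie outside both \<open>X\<close> and its
  neighbourhood: otherwise \<open>b\<close> of them and \<open>a\<close> vertices of
  \<open>X\<close> would span no edge between them.\<close>

lemma joined_neighbourhood:
  assumes "joined a b (V, E)" "finite V" "X \<subseteq> V" "a \<le> card X"
  shows "card V < card ({y \<in> V. \<exists>x\<in>X. {x, y} \<in> E} - X) + card X + b"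
proof (rule ccontr)
  assume neg: "\<not> ?thesis"
  let ?C = "{y \<in> V. \<exists>x\<in>X. {x, y} \<in> E} - X"
  have fin: "finite X" "finite ?C" using assms finite_subset by auto
  have "card (?C \<union> X) = card ?C + card X" using fin by (intro card_Un_disjoint) auto
  moreover have "card (V - (?C \<union> X)) = card V - card (?C \<union> X)"
    using fin assms by (intro card_Diff_subset) auto
  ultimately have "card (V - (?C \<union> X)) = card V - (card ?C + card X)" by simp
  then have "b \<le> card (V - (?C \<union> X))" using neg by linarith
  then obtain B where B: "B \<subseteq> V - (?C \<union> X)" "card B = b" by (meson obtain_subset_with_card_n)
  obtain A where A: "A \<subseteq> X" "card A = a" using assms(4) by (meson obtain_subset_with_card_n)
  have "\<exists>x\<in>A. \<exists>y\<in>B. {x, y} \<in> E"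
    using A B assms(3) by (intro assms(1)[unfolded joined_def fst_conv snd_conv, rule_format]) auto
  then show False using A B by auto
qed

text \<open>A maximum set \<open>B\<close> that does not expand is deleted: if a set \<open>X\<close> failed to expand in the rest,
  then \<open>B \<union> X\<close> would be a larger set that does not expand.\<close>

lemma joined_imp_expander:
  fixes V :: "'a set" and E D m b M
  assumes V: "finite V" and J: "joined m b (V, E)" and size: "(2 * D + 3) * m + b + M \<le> card V"
  obtains U where "U \<subseteq> V" "U \<noteq> {}"
    "\<And>X. X \<subseteq> U \<Longrightarrow> X \<noteq> {} \<Longrightarrow> card X \<le> m \<Longrightarrow>
       D * card X < card (\<Union>x\<in>X. {y \<in> U. {x, y} \<in> E})"
    "\<And>X. X \<subseteq> U \<Longrightarrow> m < card X \<Longrightarrow> card X \<le> 2 * m \<Longrightarrow>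
       D * card X + M \<le> card (\<Union>x\<in>X. {y \<in> U. {x, y} \<in> E})"
proof -
  let ?C = "\<lambda>X. {y \<in> V. \<exists>x\<in>X. {x, y} \<in> E} - X"
  define bad where "bad = {B. B \<subseteq> V \<and> card B \<le> 2 * m \<and> card (?C B) \<le> D * card B}"
  have size': "2 * (D * m) + 3 * m + b + M \<le> card V" using size by (simp add: algebra_simps)
  \<comment> \<open>No bad set has between \<open>m\<close> and \<open>2 * m\<close> elements:
    \<open>joined_neighbourhood\<close> would give \<open>card V < 2 * D * m + 2 * m + b\<close>,
    contrary to \<open>size\<close>.\<close>
  have bad_small: "card B < m" if "B \<in> bad" for B
  proof (rule ccontr)
    assume "\<not> card B < m"
    then have "card V < card (?C B) + card B + b"
      using that by (intro joined_neighbourhood[OF J V]) (auto simp: bad_def)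
    moreover have "D * card B \<le> 2 * (D * m)"
      using that mult_left_mono[of "card B" "2 * m" D] by (simp add: bad_def ac_simps)
    moreover have "card (?C B) \<le> D * card B" "card B \<le> 2 * m" using that by (auto simp: bad_def)
    ultimately show False using size' by linarith
  qed
  have "finite bad" using V by (auto simp: bad_def intro: finite_subset[of _ "Pow V"])
  moreover have "{} \<in> bad" by (simp add: bad_def)
  ultimately obtain B where B: "B \<in> bad" and B_max: "\<And>B'. B' \<in> bad \<Longrightarrow> card B' \<le> card B"
    using obtains_MAX[of bad card] by (metis Max_ge empty_iff finite_imageI imageI)
  have B': "B \<subseteq> V" "card (?C B) \<le> D * card B" "finite B"
    using B V finite_subset by (auto simp: bad_def)
  let ?U = "V - B"
  let ?G = "\<lambda>X. \<Union>x\<in>X. {y \<in> ?U. {x, y} \<in> E}"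
  have finG: "finite (?G X)" for X using V by (auto intro: finite_subset[of _ V])
  show thesis
  proof (rule that[of ?U])
    show "?U \<noteq> {}"
      using bad_small[OF B] size' B' by auto
    show "D * card X < card (?G X)" if X: "X \<subseteq> ?U" "X \<noteq> {}" "card X \<le> m" for X
    proof (rule ccontr)
      assume "\<not> ?thesis"
      then have le: "card (?G X) \<le> D * card X" by simp
      have finX: "finite X" using X V finite_subset by blast
      have card: "card (B \<union> X) = card B + card X"
        using X finX B' by (intro card_Un_disjoint) auto
      have "card (?C (B \<union> X)) \<le> card (?C B \<union> ?G X)"
        using V finG by (intro card_mono) auto
      also have "\<dots> \<le> card (?C B) + card (?G X)" by (rule card_Un_le)
      also have "\<dots> \<le> D * card (B \<union> X)" using le B' by (simp add: card algebra_simps)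
      \<comment> \<open>The bound \<open>2 * m\<close> in \<open>bad\<close> leaves room for this
        union, since \<open>card B < m\<close> and \<open>card X \<le> m\<close>.\<close>
      finally have "B \<union> X \<in> bad"
        using bad_small[OF B] X B' card by (auto simp: bad_def)
      from B_max[OF this] show False using card X finX by simp
    qed
    show "D * card X + M \<le> card (?G X)" if X: "X \<subseteq> ?U" "m < card X" "card X \<le> 2 * m" for X
    proof -
      have "card V < card (?C X) + card X + b"
        using X by (intro joined_neighbourhood[OF J V]) auto
      \<comment> \<open>Deleting \<open>B\<close> costs fewer than \<open>m\<close> neighbours.
        Together with the at most \<open>2 * m\<close> vertices of \<open>X\<close> this accounts
        for the term \<open>3 * m\<close> in \<open>size\<close>.\<close>
      moreover have "card (?C X) \<le> card (?G X \<union> B)"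
        using V finG B' by (intro card_mono) auto
      moreover have "card (?G X \<union> B) \<le> card (?G X) + card B" by (rule card_Un_le)
      moreover have "D * card X \<le> 2 * (D * m)"
        using mult_left_mono[OF X(3), of D] by (simp add: ac_simps)
      ultimately show ?thesis using bad_small[OF B] size' X(3) by linarith
    qed
  qed auto
qed

section \<open>From embeddings to copies of trees\<close>

lemma contains_copyI:
  assumes "simple_graph T" "inj_on f (uverts T)" "f ` uverts T \<subseteq> uverts G"
    and "\<And>u v. {u, v} \<in> uedges T \<Longrightarrow> {f u, f v} \<in> uedges G"
  shows "contains_copy G T"
proof -
  have T: "finite (uverts T)" "uedges T \<subseteq> nsets (uverts T) 2"
    using assms(1) by (auto simp: simple_graph_def)
  have sub: "e \<subseteq> uverts T" if "e \<in> uedges T" for e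
    using T(2) that by (auto simp: nsets_def)
  have pair: "\<exists>u v. e = {u, v} \<and> u \<in> uverts T \<and> v \<in> uverts T \<and> u \<noteq> v" if "e \<in> uedges T" for e
    using subsetD[OF T(2) that] by (auto simp: nsets_2_eq)
  \<comment> \<open>Only images of edges of \<open>T\<close> are taken: \<open>G\<close> may have
    further edges on the image, and the copy need not be induced.\<close>
  let ?H = "(f ` uverts T, (`) f ` uedges T)"
  have "simple_graph ?H"
  proof -
    have "f ` e \<in> nsets (f ` uverts T) 2" if "e \<in> uedges T" for e
      using pair[OF that] assms(2) by (auto simp: inj_on_def)
    then show ?thesis using T(1) by (auto simp: simple_graph_def)
  qed
  moreover have "f ` e \<in> uedges G" if "e \<in> uedges T" for e
    using pair[OF that] that assms(4) by auto
  ultimately have "ugraph_subgraph ?H G"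
    using assms(3) by (auto simp: ugraph_subgraph_def)
  moreover have "{u, v} \<in> uedges T \<longleftrightarrow> {f u, f v} \<in> uedges ?H"
    if uv: "u \<in> uverts T" "v \<in> uverts T" for u v
  proof
    assume "{f u, f v} \<in> uedges ?H"
    then obtain e where e: "e \<in> uedges T" "f ` e = f ` {u, v}" by auto
    then have "e = {u, v}" using inj_on_image_eq_iff[OF assms(2)] sub uv
      by (metis empty_subsetI insert_subset)
    with e show "{u, v} \<in> uedges T" by simp
  qed (auto intro!: image_eqI[of _ _ "{u, v}"])
  then have "ugraph_isomorphic T ?H"
    using assms(2) by (auto simp: ugraph_isomorphic_def bij_betw_def intro!: exI[of _ f])
  ultimately show ?thesis by (auto simp: contains_copy_def)
qed

lemma joined_contains_tree:
  assumes "finite (uverts G)" "joined m b G" "m \<ge> 1" "(2 * D + 3) * m + b + M \<le> card (uverts G)"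
    and T: "ugraph_tree T" "card (uverts T) \<le> M" "ugraph_max_degree T \<le> D"
  shows "contains_copy G T"
proof -
  have simple: "simple_graph T" using T by (simp add: ugraph_tree_def)
  then have "finite (uverts T)" by (simp add: simple_graph_def)
  have deg: "card {u. {u, v} \<in> uedges T} \<le> D" if "v \<in> uverts T" for v
  proof -
    have "card {u. {u, v} \<in> uedges T} \<le> ugraph_degree T v"
      by (rule simple_graph_degree_ge[OF simple that])
    also have "\<dots> \<le> ugraph_max_degree T"
      using that \<open>finite (uverts T)\<close> by (simp add: ugraph_max_degree_def)
    finally show ?thesis using T(3) by simp
  qed
  obtain U where U: "U \<subseteq> uverts G" "U \<noteq> {}"
    "\<And>X. X \<subseteq> U \<Longrightarrow> X \<noteq> {} \<Longrightarrow> card X \<le> m \<Longrightarrow>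
       D * card X < card (\<Union>x\<in>X. {y \<in> U. {x, y} \<in> uedges G})"
    "\<And>X. X \<subseteq> U \<Longrightarrow> m < card X \<Longrightarrow> card X \<le> 2 * m \<Longrightarrow>
       D * card X + M \<le> card (\<Union>x\<in>X. {y \<in> U. {x, y} \<in> uedges G})"
    using joined_imp_expander[of "uverts G" m b "uedges G" D M] assms by auto
  have "finite U" using U assms finite_subset by blast
  then have "\<exists>f. inj_on f (uverts T) \<and> f ` uverts T \<subseteq> U \<and>
      (\<forall>u v. {u, v} \<in> uedges T \<longrightarrow> {f u, f v} \<in> uedges G)"
    using U assms(3) T deg by (intro expander_embeds_tree[of U m D _ M]) auto
  then show ?thesis using contains_copyI[OF simple] U(1) by (metis subset_trans)
qed

section \<open>The random graph\<close>

lemma prob_Pi_bernoulli_all_False: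
  assumes "finite I" "F \<subseteq> I" "0 \<le> p" "p \<le> 1"
  shows "measure_pmf.prob (Pi_pmf I False (\<lambda>_. bernoulli_pmf p)) {X. \<forall>e\<in>F. \<not> X e} = (1 - p) ^ card F"
proof -
  \<comment> \<open>Written as a box, the event has as its probability the product over the
    independent coordinates.\<close>
  have eq: "{X. \<forall>e\<in>F. \<not> X e} = Pi I (\<lambda>e. if e \<in> F then {False} else UNIV)"
    using assms(2) by (auto simp: Pi_iff split: if_splits)
  have "measure_pmf.prob (Pi_pmf I False (\<lambda>_. bernoulli_pmf p)) {X. \<forall>e\<in>F. \<not> X e}
      = (\<Prod>e\<in>I. if e \<in> F then 1 - p else 1)"
    unfolding eq using assms
    by (subst measure_Pi_pmf_Pi) (auto intro!: prod.cong simp: measure_pmf_single)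
  also have "\<dots> = (1 - p) ^ card F"
    using assms by (simp add: prod.If_cases Int_absorb1)
  finally show ?thesis .
qed

text \<open>This is the union bound over all disjoint pairs \<open>(A, B)\<close> of the given
  sizes. Disjointness makes the \<open>a * b\<close> potential edges between them distinct, and all
  of them must be absent.\<close>

lemma gnp_not_joined_le:
  assumes "0 \<le> p" "p \<le> 1"
  shows "measure_pmf.prob (gnp n p) {G. \<not> joined a b G}
           \<le> real (n choose a) * real (n choose b) * (1 - p) ^ (a * b)"
proof -
  let ?I = "nsets {..<n} 2"
  let ?P = "Pi_pmf ?I False (\<lambda>_. bernoulli_pmf p)"
  define pairs where "pairs = {(A, B). A \<in> nsets {..<n} a \<and> B \<in> nsets {..<n} b \<and> A \<inter> B = {}}"
  define F where "F = (\<lambda>(A :: nat set, B :: nat set). (\<lambda>(x, y). {x, y}) ` (A \<times> B))"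
  have sub: "pairs \<subseteq> nsets {..<n} a \<times> nsets {..<n} b" by (auto simp: pairs_def)
  have finI: "finite (nsets {..<n} k)" for k by (simp add: finite_imp_finite_nsets)
  have fin: "finite pairs" using finite_subset[OF sub] finI by blast
  have F: "F q \<subseteq> ?I" "card (F q) = a * b" if "q \<in> pairs" for q
  proof -
    obtain A B where q: "q = (A, B)" by (cases q)
    have AB: "A \<subseteq> {..<n}" "B \<subseteq> {..<n}" "card A = a" "card B = b" "A \<inter> B = {}"
      using that by (auto simp: q pairs_def nsets_def)
    show "F q \<subseteq> ?I" using AB by (auto simp: q F_def)
    have "inj_on (\<lambda>(x, y). {x, y}) (A \<times> B)"
      using AB(5) by (auto simp: inj_on_def doubleton_eq_iff)
    then show "card (F q) = a * b"
      using AB by (simp add: q F_def card_image card_cartesian_product)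
  qed
  have "measure_pmf.prob (gnp n p) {G. \<not> joined a b G}
      = measure_pmf.prob ?P {X. \<not> joined a b ({..<n}, {e \<in> ?I. X e})}"
    by (simp add: gnp_def vimage_def)
  also have "\<dots> \<le> measure_pmf.prob ?P (\<Union>q\<in>pairs. {X. \<forall>e\<in>F q. \<not> X e})"
  proof (rule measure_pmf.finite_measure_mono)
    show "{X. \<not> joined a b ({..<n}, {e \<in> ?I. X e})} \<subseteq> (\<Union>q\<in>pairs. {X. \<forall>e\<in>F q. \<not> X e})"
    proof safe
      fix X assume "\<not> joined a b ({..<n}, {e \<in> ?I. X e})"
      then obtain A B where AB: "A \<subseteq> {..<n}" "B \<subseteq> {..<n}" "A \<inter> B = {}" "card A = a" "card B = b"
        and no: "\<forall>x\<in>A. \<forall>y\<in>B. {x, y} \<notin> {e \<in> ?I. X e}"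
        by (auto simp: joined_def)
      have q: "(A, B) \<in> pairs"
        using AB by (auto simp: pairs_def nsets_def intro: finite_subset[of _ "{..<n}"])
      have "\<forall>e\<in>F (A, B). \<not> X e"
      proof
        fix e assume "e \<in> F (A, B)"
        moreover from this obtain x y where "x \<in> A" "y \<in> B" "e = {x, y}" by (auto simp: F_def)
        ultimately show "\<not> X e" using no F(1)[OF q] by blast
      qed
      with q show "X \<in> (\<Union>q\<in>pairs. {X. \<forall>e\<in>F q. \<not> X e})" by blast
    qed
  qed simp
  also have "\<dots> \<le> (\<Sum>q\<in>pairs. measure_pmf.prob ?P {X. \<forall>e\<in>F q. \<not> X e})"
    using fin by (intro measure_pmf.finite_measure_subadditive_finite) auto
  also have "\<dots> = (\<Sum>q\<in>pairs. (1 - p) ^ (a * b))"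
    using F finI assms by (intro sum.cong refl) (simp add: prob_Pi_bernoulli_all_False)
  also have "\<dots> = real (card pairs) * (1 - p) ^ (a * b)" by simp
  also have "\<dots> \<le> real ((n choose a) * (n choose b)) * (1 - p) ^ (a * b)"
  proof (intro mult_right_mono)
    have "card pairs \<le> card (nsets {..<n} a \<times> nsets {..<n} b)"
      using finI by (intro card_mono sub) auto
    also have "\<dots> = (n choose a) * (n choose b)" by (simp add: card_cartesian_product)
    finally show "real (card pairs) \<le> real ((n choose a) * (n choose b))" by (rule of_nat_mono)
  qed (use assms in auto)
  finally show ?thesis by simp
qed

section \<open>Asymptotics of the union bound\<close>

text \<open>The bound is \<open>(e / x)\<close> to the power \<open>x * n\<close>. It comes from one
  term of the expansion of \<open>(1 + x) ^ n\<close>, which is at most \<open>exp (x * n)\<close>;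
  lowering \<open>x ^ k\<close> to \<open>x\<close> to the power \<open>x * n\<close> is allowed as
  \<open>x \<le> 1\<close>.\<close>

lemma binomial_le_exp:
  fixes x :: real
  assumes "0 < x" "x \<le> 1" "real k \<le> x * real n"
  shows "real (n choose k) \<le> exp (x * (1 - ln x) * real n)"
proof -
  have "real k \<le> real n" using assms mult_right_mono[of x 1 "real n"] by simp
  then have "real (n choose k) * x ^ k * 1 ^ (n - k) \<le> (\<Sum>i\<le>n. real (n choose i) * x ^ i * 1 ^ (n - i))"
    using assms by (intro member_le_sum) auto
  also have "\<dots> = (x + 1) ^ n" by (rule binomial_ring[symmetric])
  also have "\<dots> \<le> exp x ^ n" using assms exp_ge_add_one_self[of x] by (intro power_mono) (auto simp: add.commute)
  also have "\<dots> = exp (x * real n)" by (simp add: exp_of_nat_mult[symmetric] mult.commute)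
  finally have 1: "real (n choose k) * x ^ k \<le> exp (x * real n)" by simp
  have "exp (x * real n * ln x) \<le> exp (real k * ln x)"
    using assms by (simp add: mult_right_mono_neg)
  also have "\<dots> = x ^ k" using assms by (simp add: exp_of_nat_mult)
  finally have "real (n choose k) * exp (x * real n * ln x) \<le> real (n choose k) * x ^ k"
    by (intro mult_left_mono) auto
  with 1 have "real (n choose k) * exp (x * real n * ln x) \<le> exp (x * real n)" by linarith
  then have "real (n choose k) \<le> exp (x * real n) / exp (x * real n * ln x)"
    by (simp add: field_simps)
  also have "\<dots> = exp (x * (1 - ln x) * real n)" by (simp add: exp_diff[symmetric] algebra_simps)
  finally show ?thesis .
qed

text \<open>The two binomials contribute the left side of \<open>gap\<close> to the exponent per
  vertex, and the absent edges contribute minus its right side. Up to a constant factor the union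
  bound is therefore \<open>exp (- \<delta> * n)\<close>.\<close>

lemma gnp_joined_tendsto:
  fixes \<alpha> \<beta> c :: real
  assumes \<alpha>: "0 < \<alpha>" "\<alpha> \<le> 1" and \<beta>: "0 < \<beta>" "\<beta> \<le> 1" and c: "0 < c"
    and gap: "\<alpha> * (1 - ln \<alpha>) + \<beta> * (1 - ln \<beta>) < c * \<alpha> * \<beta>"
  shows "(\<lambda>n. measure_pmf.prob (gnp n (c / real n))
           {G. \<not> joined (nat \<lfloor>\<alpha> * real n\<rfloor>) (nat \<lfloor>\<beta> * real n\<rfloor>) G}) \<longlonglongrightarrow> 0"
proof -
  define \<delta> where "\<delta> = c * \<alpha> * \<beta> - (\<alpha> * (1 - ln \<alpha>) + \<beta> * (1 - ln \<beta>))"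
  have "\<delta> > 0" using gap by (simp add: \<delta>_def)
  let ?P = "\<lambda>n. measure_pmf.prob (gnp n (c / real n))
           {G. \<not> joined (nat \<lfloor>\<alpha> * real n\<rfloor>) (nat \<lfloor>\<beta> * real n\<rfloor>) G}"
  \<comment> \<open>The first condition makes \<open>c / n\<close> a probability; the second makes
    \<open>\<alpha> * n - 1\<close> nonnegative, as multiplying the floor estimates requires. The
    constant \<open>c * (\<alpha> + \<beta>)\<close> is the price of rounding down.\<close>
  have bound: "?P n \<le> exp (c * (\<alpha> + \<beta>) - \<delta> * real n)" if n: "real n \<ge> c" "real n * \<alpha> \<ge> 1" for n
  proof -
    let ?a = "nat \<lfloor>\<alpha> * real n\<rfloor>" and ?b = "nat \<lfloor>\<beta> * real n\<rfloor>"
    have n0: "real n > 0" using n c by linarith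
    have p: "0 \<le> c / real n" "c / real n \<le> 1" using n c n0 by auto
    have a: "real ?a \<le> \<alpha> * real n" "\<alpha> * real n - 1 \<le> real ?a"
      using \<alpha> by (auto intro: of_nat_floor)
    have b: "real ?b \<le> \<beta> * real n" "\<beta> * real n - 1 \<le> real ?b"
      using \<beta> by (auto intro: of_nat_floor)
    have "(\<alpha> * real n - 1) * (\<beta> * real n - 1) \<le> (\<alpha> * real n - 1) * real ?b"
      using n b by (intro mult_left_mono) (auto simp: mult.commute)
    also have "\<dots> \<le> real ?a * real ?b" using a by (intro mult_right_mono) auto
    finally have ab: "(\<alpha> * real n - 1) * (\<beta> * real n - 1) \<le> real (?a * ?b)" by simp
    have "(1 - c / real n) ^ (?a * ?b) \<le> exp (- (c / real n)) ^ (?a * ?b)"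
      using p exp_ge_add_one_self[of "- (c / real n)"] by (intro power_mono) auto
    also have "\<dots> = exp (- (c / real n) * real (?a * ?b))"
      by (simp add: exp_of_nat_mult[symmetric] mult.commute)
    also have "\<dots> \<le> exp (c * (\<alpha> + \<beta>) - c * \<alpha> * \<beta> * real n)"
    proof -
      have "c / real n * ((\<alpha> * real n - 1) * (\<beta> * real n - 1)) \<le> c / real n * real (?a * ?b)"
        using p by (intro mult_left_mono ab)
      moreover have "c / real n * ((\<alpha> * real n - 1) * (\<beta> * real n - 1))
          = c * \<alpha> * \<beta> * real n - c * (\<alpha> + \<beta>) + c / real n"
        using n0 by (simp add: field_simps)
      ultimately show ?thesis using p by simp
    qed
    finally have "real (n choose ?a) * real (n choose ?b) * (1 - c / real n) ^ (?a * ?b)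
        \<le> exp (\<alpha> * (1 - ln \<alpha>) * real n) * exp (\<beta> * (1 - ln \<beta>) * real n)
           * exp (c * (\<alpha> + \<beta>) - c * \<alpha> * \<beta> * real n)"
      using p a b \<alpha> \<beta> by (intro mult_mono binomial_le_exp) auto
    also have "\<dots> = exp (c * (\<alpha> + \<beta>) - \<delta> * real n)"
      by (simp add: exp_add[symmetric] \<delta>_def algebra_simps)
    finally show ?thesis
      using gnp_not_joined_le[OF p, of n ?a ?b] by linarith
  qed
  have ev: "\<forall>\<^sub>F n in sequentially. real n \<ge> c \<and> real n * \<alpha> \<ge> 1"
    using \<alpha> by (intro eventually_conj; real_asymp)
  have lim: "(\<lambda>n. exp (c * (\<alpha> + \<beta>) - \<delta> * real n)) \<longlonglongrightarrow> 0"
    using \<open>\<delta> > 0\<close> by real_asymp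
  show ?thesis
    by (rule tendsto_sandwich[OF _ _ tendsto_const lim]) (use ev bound in \<open>auto elim: eventually_mono\<close>)
qed

theorem theorem1p5:
  fixes \<Delta> :: nat and \<epsilon> c :: real
  assumes "\<Delta> \<ge> 2" and "0 < \<epsilon>" and "\<epsilon> < 1/2"
    and "c \<ge> (30 * real \<Delta> / \<epsilon>) * ln (4 * exp 1 / \<epsilon>)"
  shows "(\<lambda>n. measure_pmf.prob (gnp n (c / real n))
            {G. \<forall>T :: nat ugraph. ugraph_tree T \<and> real (card (uverts T)) \<le> (1 - \<epsilon>) * real n \<and>
                  ugraph_max_degree T \<le> \<Delta> \<longrightarrow> contains_copy G T}) \<longlonglongrightarrow> 1"
proof -
  define L where "L = ln (4 * exp 1 / \<epsilon>)"
  have L: "L = ln 4 + 1 - ln \<epsilon>" using assms by (simp add: L_def ln_div ln_mult)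
  have "ln \<epsilon> \<le> 0" "ln (4 :: real) \<ge> 0" using assms by auto
  then have "L \<ge> 1" unfolding L by linarith
  \<comment> \<open>Since \<open>\<Delta> \<ge> 2\<close>, the factor
    \<open>2 * \<Delta> + 3\<close> is at most \<open>7 / 2 * \<Delta>\<close>. Hence
    \<open>(2 * \<Delta> + 3) * \<alpha>\<close> and \<open>\<beta>\<close> are each at most
    \<open>\<epsilon> / 2\<close>, which leaves \<open>(1 - \<epsilon>) * n\<close> vertices for the
    tree.\<close>
  define \<alpha> where "\<alpha> = \<epsilon> / (7 * real \<Delta>)"
  define \<beta> where "\<beta> = \<epsilon> / 2"
  have \<Delta>: "real \<Delta> \<ge> 2" using assms by simp
  have \<alpha>: "0 < \<alpha>" "\<alpha> \<le> 1" using assms \<Delta> by (auto simp: \<alpha>_def field_simps)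
  have \<beta>: "0 < \<beta>" "\<beta> \<le> 1" using assms by (auto simp: \<beta>_def)
  have "0 < (30 * real \<Delta> / \<epsilon>) * L" using assms \<Delta> \<open>L \<ge> 1\<close> by (intro mult_pos_pos) auto
  then have c: "0 < c" using assms(4) by (simp add: L_def)
  have gap: "\<alpha> * (1 - ln \<alpha>) + \<beta> * (1 - ln \<beta>) < c * \<alpha> * \<beta>"
  proof -
    \<comment> \<open>The summand \<open>ln 4\<close> is split off because it occurs in
      \<open>L\<close>. The rest is bounded linearly in \<open>\<Delta>\<close>, which the factor
      \<open>\<alpha>\<close> turns into \<open>\<epsilon> / 4\<close>.\<close>
    have "ln (7 * real \<Delta>) = ln 4 + ln (7 / 4 * real \<Delta>)"
      using \<Delta> by (subst ln_mult_pos[symmetric]) auto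
    also have "\<dots> \<le> ln 4 + 7 / 4 * real \<Delta>"
      using \<Delta> ln_le_minus_one[of "7 / 4 * real \<Delta>"] by simp
    finally have "1 - ln \<alpha> \<le> L + 7 / 4 * real \<Delta>"
      using assms \<Delta> by (simp add: \<alpha>_def L ln_div)
    then have "\<alpha> * (1 - ln \<alpha>) \<le> \<alpha> * (L + 7 / 4 * real \<Delta>)" using \<alpha> by (intro mult_left_mono) auto
    also have "\<dots> = \<alpha> * L + \<epsilon> / 4" using \<Delta> by (simp add: \<alpha>_def field_simps)
    also have "\<dots> \<le> \<epsilon> / 14 * L + \<epsilon> / 4 * L"
    proof (rule add_mono)
      show "\<alpha> * L \<le> \<epsilon> / 14 * L"
        using assms \<Delta> \<open>L \<ge> 1\<close> by (intro mult_right_mono) (auto simp: \<alpha>_def field_simps)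
      show "\<epsilon> / 4 \<le> \<epsilon> / 4 * L" using assms \<open>L \<ge> 1\<close> by simp
    qed
    finally have 1: "\<alpha> * (1 - ln \<alpha>) \<le> \<epsilon> * L * (9 / 28)" by (simp add: mult.commute)
    have "ln (2 :: real) \<le> ln 4" by simp
    then have "1 - ln \<beta> \<le> L" using assms by (simp add: \<beta>_def L ln_div)
    then have 2: "\<beta> * (1 - ln \<beta>) \<le> \<epsilon> * L * (1 / 2)"
      using mult_left_mono[of "1 - ln \<beta>" L \<beta>] \<beta> by (simp add: \<beta>_def)
    \<comment> \<open>The coefficient is \<open>23 / 28\<close> here, while the assumed lower bound
      on \<open>c\<close> gives \<open>30 / (7 * 2) = 15 / 7\<close> on the other side.\<close>
    have "\<alpha> * (1 - ln \<alpha>) + \<beta> * (1 - ln \<beta>) \<le> \<epsilon> * L * (9 / 28) + \<epsilon> * L * (1 / 2)"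
      by (rule add_mono[OF 1 2])
    also have "\<dots> < \<epsilon> * L * (15 / 7)" using assms \<open>L \<ge> 1\<close> by simp
    also have "\<dots> = (30 * real \<Delta> / \<epsilon> * L) * (\<alpha> * \<beta>)"
      using assms \<Delta> by (simp add: \<alpha>_def \<beta>_def field_simps)
    also have "\<dots> \<le> c * (\<alpha> * \<beta>)"
      using assms(4) \<alpha> \<beta> by (intro mult_right_mono) (auto simp: L_def)
    finally show ?thesis by (simp add: mult.assoc)
  qed
  let ?m = "\<lambda>n. nat \<lfloor>\<alpha> * real n\<rfloor>" and ?b = "\<lambda>n. nat \<lfloor>\<beta> * real n\<rfloor>"
  let ?Q = "\<lambda>n. {G. \<forall>T :: nat ugraph. ugraph_tree T \<and> real (card (uverts T)) \<le> (1 - \<epsilon>) * real n \<and>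
                  ugraph_max_degree T \<le> \<Delta> \<longrightarrow> contains_copy G T}"
  let ?pr = "\<lambda>n. measure_pmf.prob (gnp n (c / real n))"
  have lower: "1 - ?pr n {G. \<not> joined (?m n) (?b n) G} \<le> ?pr n (?Q n)" if n: "\<alpha> * real n \<ge> 1" for n
  proof -
    let ?M = "nat \<lfloor>(1 - \<epsilon>) * real n\<rfloor>"
    have "real ((2 * \<Delta> + 3) * ?m n + ?b n + ?M) \<le> (2 * real \<Delta> + 3) * (\<alpha> * real n) + \<beta> * real n + (1 - \<epsilon>) * real n"
      using \<alpha> \<beta> assms by (auto intro!: add_mono mult_left_mono of_nat_floor)
    also have "\<dots> = ((2 * real \<Delta> + 3) * \<alpha> + \<epsilon> / 2 + (1 - \<epsilon>)) * real n"
      by (simp add: \<beta>_def algebra_simps)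
    also have "\<dots> \<le> 1 * real n"
    proof (rule mult_right_mono)
      have "(2 * real \<Delta> + 3) * \<alpha> \<le> (7 / 2 * real \<Delta>) * \<alpha>"
        using \<Delta> \<alpha> by (intro mult_right_mono) auto
      also have "\<dots> = \<epsilon> / 2" using \<Delta> by (simp add: \<alpha>_def)
      finally show "(2 * real \<Delta> + 3) * \<alpha> + \<epsilon> / 2 + (1 - \<epsilon>) \<le> 1" by simp
    qed simp
    finally have size: "(2 * \<Delta> + 3) * ?m n + ?b n + ?M \<le> n"
      unfolding mult_1 of_nat_le_iff .
    have m1: "?m n \<ge> 1" using n by (simp add: le_nat_iff le_floor_iff)
    have "contains_copy G T"
      if G: "G \<in> set_pmf (gnp n (c / real n))" "joined (?m n) (?b n) G"
        and T: "ugraph_tree T" "real (card (uverts T)) \<le> (1 - \<epsilon>) * real n" "ugraph_max_degree T \<le> \<Delta>"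
      for G and T :: "nat ugraph"
    proof -
      have "uverts G = {..<n}" using G(1) by (auto simp: gnp_def)
      moreover have "card (uverts T) \<le> ?M" using T(2) by (simp add: le_nat_floor)
      ultimately show ?thesis
        using size m1 T G by (intro joined_contains_tree[of G "?m n" "?b n" \<Delta> ?M]) auto
    qed
    \<comment> \<open>The inclusion of events is used almost surely: only graphs in the support are
      known to have vertex set \<open>{..<n}\<close>.\<close>
    then have "?pr n (- {G. \<not> joined (?m n) (?b n) G}) \<le> ?pr n (?Q n)"
      by (intro measure_pmf.finite_measure_mono_AE) (auto simp: AE_measure_pmf_iff)
    then show ?thesis by (simp add: measure_pmf.prob_compl[symmetric] Compl_eq_Diff_UNIV)
  qed
  have "(\<lambda>n. 1 - ?pr n {G. \<not> joined (?m n) (?b n) G}) \<longlonglongrightarrow> 1 - 0"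
    by (intro tendsto_diff tendsto_const gnp_joined_tendsto \<alpha> \<beta> c gap)
  then have lim: "(\<lambda>n. 1 - ?pr n {G. \<not> joined (?m n) (?b n) G}) \<longlonglongrightarrow> 1" by simp
  have "\<forall>\<^sub>F n in sequentially. \<alpha> * real n \<ge> 1" using \<alpha> by real_asymp
  then have "\<forall>\<^sub>F n in sequentially. 1 - ?pr n {G. \<not> joined (?m n) (?b n) G} \<le> ?pr n (?Q n)"
    by (rule eventually_mono) (rule lower)
  then show ?thesis
    by (rule tendsto_sandwich[OF _ _ lim tendsto_const]) simp
qed

end
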